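(* Let $n\ge3$ and let $m_1<\cdots<m_n$ be positive integers with $m_i=h\,m_1+(i-1)d$ for all $i\in\{2,\ldots,n\}$, where $h,d\in\mathbb{Z}^+$, $\gcd\{m_1,d\}=1$, $h>1$ and $h$ divides $d$. Set $\delta:=\lfloor(m_1-1)/(n-1)\rfloor h+d+h$ and, for $j\in\{0,\ldots,\delta/h-1\}$, $\beta_j:=\min\{b\in\mathbb{Z}^+\mid (jh)m_1+b\,m_2\in\sum_{i=3}^n\mathbb{N}m_i\}$. Then the Hilbert series of $K[\mathcal{C}]$ is $$\mathcal{H}_{K[\mathcal{C}]}(t)=(1+\cdots+t^{h-1})\,\mathcal{H}_{K[\mathcal{C}']}(t)+\frac{\sum_{j=h}^{\delta-1}t^j-\left(\sum_{j=0}^{h-1}t^j\right)\left(\sum_{i=1}^{(\delta/h)-1}t^{ih+\beta_i}\right)}{(1-t)^2},$$ where $\mathcal{H}_{K[\mathcal{C}']}(t)$ is the Hilbert series of $K[\mathcal{C}']$ and $\mathcal{C}'$ is the projective monomial curve associated to the arithmetic sequence $m_2<\cdots<m_n$.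
   Context: $K$ is an infinite field, $R=K[x_1,\ldots,x_{n+1}]$ with its standard grading, $0\in\mathbb{N}$. The projective monomial curve $\mathcal{C}\subset\mathbb{P}^n_K$ associated to $m_1<\cdots<m_n$ has vanishing ideal $I(\mathcal{C})\subset R$ equal to the kernel of the $K$-algebra homomorphism $R\to K[u,v]$, $x_i\mapsto u^{m_i}v^{m_n-m_i}$ ($1\le i\le n$), $x_{n+1}\mapsto v^{m_n}$, and $K[\mathcal{C}]=R/I(\mathcal{C})$. Likewise $I(\mathcal{C}')\subset K[x_2,\ldots,x_{n+1}]$ is the kernel of the restriction of this homomorphism to $K[x_2,\ldots,x_{n+1}]$, and $K[\mathcal{C}']=K[x_2,\ldots,x_{n+1}]/I(\mathcal{C}')$. For a standard graded quotient $A$ of a polynomial ring by a homogeneous ideal, its Hilbert series is $\mathcal{H}_A(t)=\sum_{s\in\mathbb{N}}\dim_K(A_s)\,t^s$. *)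

theory Defs
  imports
    "HOL-Library.Poly_Mapping"
    "HOL-Computational_Algebra.Formal_Power_Series"
    "HOL-Algebra.QuotRing"
    "HOL-Algebra.Embedded_Algebras"
begin

section \<open>Polynomial rings in finitely many variables\<close>

text \<open>
  A polynomial is a finitely supported function from exponent vectors to coefficients; the variables
  are indexed by natural numbers. The multiplication of \<^theory>\<open>HOL-Library.Poly_Mapping\<close> is
  convolution, i.e. the product of polynomials.
\<close>

type_synonym 'a mpoly = "(nat \<Rightarrow>\<^sub>0 nat) \<Rightarrow>\<^sub>0 'a"

definition mpoly_const :: "'a::zero \<Rightarrow> 'a mpoly" where
  "mpoly_const c = Poly_Mapping.single 0 c"

definition mpoly_var :: "nat \<Rightarrow> 'a::zero_neq_one mpoly" where
  "mpoly_var i = Poly_Mapping.single (Poly_Mapping.single i 1) 1"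

definition mpoly_ring :: "nat set \<Rightarrow> 'a::comm_ring_1 mpoly ring" where
  "mpoly_ring V =
     \<lparr>carrier = {p. \<forall>t \<in> Poly_Mapping.keys p. Poly_Mapping.keys t \<subseteq> V},
      mult = (*), one = 1, zero = 0, add = (+)\<rparr>"

definition monom_degree :: "(nat \<Rightarrow>\<^sub>0 nat) \<Rightarrow> nat" where
  "monom_degree t = (\<Sum>i \<in> Poly_Mapping.keys t. Poly_Mapping.lookup t i)"

definition homogeneous_part :: "nat set \<Rightarrow> nat \<Rightarrow> 'a::comm_ring_1 mpoly set" where
  "homogeneous_part V s =
     {p \<in> carrier (mpoly_ring V). \<forall>t \<in> Poly_Mapping.keys p. monom_degree t = s}"

text \<open>The \<open>K\<close>-algebra homomorphism that sends the variable with index \<open>i\<close> to \<open>g i\<close>:\<close>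

definition mpoly_subst :: "(nat \<Rightarrow> 'a mpoly) \<Rightarrow> 'a::comm_ring_1 mpoly \<Rightarrow> 'a mpoly" where
  "mpoly_subst g p =
     (\<Sum>t \<in> Poly_Mapping.keys p. mpoly_const (Poly_Mapping.lookup p t) *
        (\<Prod>i \<in> Poly_Mapping.keys t. g i ^ Poly_Mapping.lookup t i))"

section \<open>Hilbert series\<close>

text \<open>
  For a homogeneous ideal \<open>I\<close> of \<open>K[x\<^sub>i | i \<in> V]\<close>, the degree \<open>s\<close> component of the quotient ring is
  the set of residue classes of the forms of degree \<open>s\<close>. Its dimension is taken over the copy of \<open>K\<close>
  in the quotient ring, that is, over the residue classes of the constants.
\<close>

definition hilbert_function :: "nat set \<Rightarrow> 'a::field mpoly set \<Rightarrow> nat \<Rightarrow> nat" where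
  "hilbert_function V I s =
     ring.dim (mpoly_ring V Quot I)
       (range (\<lambda>c. I +>\<^bsub>mpoly_ring V\<^esub> mpoly_const c))
       ((\<lambda>p. I +>\<^bsub>mpoly_ring V\<^esub> p) ` homogeneous_part V s)"

definition hilbert_series :: "nat set \<Rightarrow> 'a::field mpoly set \<Rightarrow> rat fps" where
  "hilbert_series V I = Abs_fps (\<lambda>s. of_nat (hilbert_function V I s))"

section \<open>Projective monomial curves\<close>

text \<open>In the target ring \<open>K[u,v]\<close>, \<open>u\<close> is the variable with index 0 and \<open>v\<close> the one with index 1.\<close>

definition curve_param :: "nat \<Rightarrow> (nat \<Rightarrow> nat) \<Rightarrow> nat \<Rightarrow> 'a::comm_ring_1 mpoly" where
  "curve_param n m i =
     (if i = n + 1 then mpoly_var 1 ^ m n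
      else mpoly_var 0 ^ m i * mpoly_var 1 ^ (m n - m i))"

text \<open>
  The vanishing ideal in \<open>K[x\<^sub>k, \<dots>, x\<^bsub>n+1\<^esub>]\<close> of the projective monomial curve associated to
  \<open>m\<^sub>k < \<dots> < m\<^sub>n\<close>.
\<close>

definition curve_ideal :: "nat \<Rightarrow> nat \<Rightarrow> (nat \<Rightarrow> nat) \<Rightarrow> 'a::field mpoly set" where
  "curve_ideal k n m =
     a_kernel (mpoly_ring {k..n+1}) (mpoly_ring {0, 1}) (mpoly_subst (curve_param n m))"

definition nat_combinations :: "nat set \<Rightarrow> (nat \<Rightarrow> nat) \<Rightarrow> nat set" where
  "nat_combinations A m = {\<Sum>i\<in>A. c i * m i | c. True}"

end

theory Submission
  imports Defs
begin

text \<open>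
  The Hilbert function of a projective monomial curve counts the values of the sums of at most \<open>s\<close>
  of the \<open>m\<^sub>i\<close>. Since \<open>h\<close> divides \<open>m\<^sub>2, \<dots>, m\<^sub>n\<close> and is coprime to \<open>m\<^sub>1\<close>, the number of copies
  of \<open>m\<^sub>1\<close> modulo \<open>h\<close> is determined by the value, which yields the factor \<open>1 + \<dots> + t\<^bsup>h-1\<^esup>\<close>. It
  remains to adjoin \<open>h m\<^sub>1\<close>, in degree \<open>h\<close>, to the semigroup of \<open>m\<^sub>2, \<dots>, m\<^sub>n\<close>. As
  \<open>h m\<^sub>1 + m\<^sub>i = m\<^sub>2 + m\<^bsub>i-1\<^esub>\<close> for \<open>i \<ge> 3\<close>, the only new elements with \<open>j\<close> copies of \<open>h m\<^sub>1\<close> are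
  \<open>j h m\<^sub>1 + b m\<^sub>2\<close>, which are new exactly for \<open>b < \<beta>\<^sub>j\<close> and \<open>j < \<delta> / h\<close>; for fixed \<open>j\<close> they
  contribute \<open>(t\<^bsup>jh\<^esup> - t\<^bsup>jh + \<beta>(j)\<^esup>) / (1 - t)\<^sup>2\<close>.
\<close>

section \<open>Hilbert functions of curves parametrised by monomials\<close>

lemma keys_sum_subset: "Poly_Mapping.keys (sum f A) \<subseteq> (\<Union>a\<in>A. Poly_Mapping.keys (f a))"
proof (induction A rule: infinite_finite_induct)
  case (insert x F)
  then show ?case
    using keys_add[of "f x" "sum f F"] by auto
qed auto

lemma poly_mapping_sum_singles:
  fixes p :: "'b \<Rightarrow>\<^sub>0 'c::comm_monoid_add"
  shows "p = (\<Sum>t\<in>Poly_Mapping.keys p. Poly_Mapping.single t (Poly_Mapping.lookup p t))"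
proof (rule poly_mapping_eqI)
  fix k
  have "(\<Sum>t\<in>Poly_Mapping.keys p. Poly_Mapping.lookup (Poly_Mapping.single t (Poly_Mapping.lookup p t)) k)
      = (\<Sum>t\<in>Poly_Mapping.keys p. if t = k then Poly_Mapping.lookup p t else 0)"
    by (intro sum.cong) (auto simp: lookup_single when_def)
  then show "Poly_Mapping.lookup p k = Poly_Mapping.lookup
      (\<Sum>t\<in>Poly_Mapping.keys p. Poly_Mapping.single t (Poly_Mapping.lookup p t)) k"
    by (simp add: lookup_sum not_in_keys_iff_lookup_eq_zero)
qed

lemma poly_mapping_single_add_induct [case_names zero add]:
  fixes p :: "'b \<Rightarrow>\<^sub>0 'c::comm_monoid_add"
  assumes "P 0" and "\<And>t c q. P q \<Longrightarrow> P (Poly_Mapping.single t c + q)"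
  shows "P p"
proof -
  have "P (\<Sum>t\<in>A. Poly_Mapping.single t (Poly_Mapping.lookup p t))" if "finite A" for A
    using that by (induction A) (auto intro: assms)
  from this[of "Poly_Mapping.keys p"] show ?thesis
    by (simp flip: poly_mapping_sum_singles)
qed

lemma mpoly_const_add: "mpoly_const (a + b) = mpoly_const a + mpoly_const b"
  by (simp add: mpoly_const_def single_add)

lemma mpoly_const_mult: "mpoly_const (a * b) = mpoly_const a * mpoly_const b"
  by (simp add: mpoly_const_def mult_single)

lemma mpoly_subst_0 [simp]: "mpoly_subst g 0 = 0"
  by (simp add: mpoly_subst_def)

lemma mpoly_subst_single:
  "mpoly_subst g (Poly_Mapping.single t c) =
     mpoly_const c * (\<Prod>i\<in>Poly_Mapping.keys t. g i ^ Poly_Mapping.lookup t i)"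
  by (cases "c = 0") (auto simp: mpoly_subst_def mpoly_const_def)

lemma mpoly_subst_add: "mpoly_subst g (p + q) = mpoly_subst g p + mpoly_subst g q"
  unfolding mpoly_subst_def
  by (rule setsum_keys_plus_distrib) (auto simp: mpoly_const_def single_add algebra_simps)

lemma prod_keys_power_add:
  fixes g :: "'b \<Rightarrow> 'c::comm_monoid_mult"
  shows "(\<Prod>i\<in>Poly_Mapping.keys (s + t). g i ^ Poly_Mapping.lookup (s + t) i) =
    (\<Prod>i\<in>Poly_Mapping.keys s. g i ^ Poly_Mapping.lookup s i) *
    (\<Prod>i\<in>Poly_Mapping.keys t. g i ^ Poly_Mapping.lookup t i)"
proof -
  \<comment> \<open>Over the union of both supports the added factors are
    \<open>g i ^ 0 = 1\<close>, so the three products can be compared factor by factor.\<close>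
  let ?A = "Poly_Mapping.keys s \<union> Poly_Mapping.keys t"
  have "(\<Prod>i\<in>Poly_Mapping.keys u. g i ^ Poly_Mapping.lookup u i) =
      (\<Prod>i\<in>?A. g i ^ Poly_Mapping.lookup u i)"
    if "Poly_Mapping.keys u \<subseteq> ?A" for u
    using that by (intro prod.mono_neutral_left) (auto simp: in_keys_iff)
  note this[of s] this[of t] this[OF keys_add]
  then show ?thesis
    by (simp add: lookup_add power_add prod.distrib del: prod.union_disjoint)
qed

lemma mpoly_subst_mult: "mpoly_subst g (p * q) = mpoly_subst g p * mpoly_subst g q"
proof (induction p rule: poly_mapping_single_add_induct)
  case (add t c p)
  have "mpoly_subst g (Poly_Mapping.single t c * q) =
      mpoly_subst g (Poly_Mapping.single t c) * mpoly_subst g q"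
  proof (induction q rule: poly_mapping_single_add_induct)
    case (add s b q)
    then show ?case
      by (simp add: distrib_left mpoly_subst_add mult_single mpoly_subst_single
          prod_keys_power_add mpoly_const_mult mult_ac)
  qed simp
  with add show ?case
    by (simp add: distrib_right mpoly_subst_add)
qed simp

lemma mpoly_subst_1: "mpoly_subst g 1 = 1"
  using mpoly_subst_single[of g 0 1] by (simp add: mpoly_const_def)

section \<open>The polynomial ring as a commutative ring with explicit carrier\<close>

lemma mpoly_ring_sel:
  "mult (mpoly_ring V) = (*)" "one (mpoly_ring V) = 1" "zero (mpoly_ring V) = 0"
  "add (mpoly_ring V) = (+)"
  by (simp_all add: mpoly_ring_def)

lemma carrier_mpoly_ring_iff:
  "p \<in> carrier (mpoly_ring V) \<longleftrightarrow> (\<forall>t\<in>Poly_Mapping.keys p. Poly_Mapping.keys t \<subseteq> V)"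
  by (simp add: mpoly_ring_def)

lemma cring_mpoly_ring: "cring (mpoly_ring V :: 'a::comm_ring_1 mpoly ring)"
proof (intro cringI abelian_groupI comm_monoidI)
  fix x y :: "'a mpoly"
  assume xy: "x \<in> carrier (mpoly_ring V)" "y \<in> carrier (mpoly_ring V)"
  then show "x \<oplus>\<^bsub>mpoly_ring V\<^esub> y \<in> carrier (mpoly_ring V)"
    using keys_add[of x y] by (auto simp: carrier_mpoly_ring_iff mpoly_ring_sel)
  have "Poly_Mapping.keys (s + t) \<subseteq> V"
    if "s \<in> Poly_Mapping.keys x" "t \<in> Poly_Mapping.keys y" for s t
    using that xy keys_add[of s t] unfolding carrier_mpoly_ring_iff by blast
  then show "x \<otimes>\<^bsub>mpoly_ring V\<^esub> y \<in> carrier (mpoly_ring V)"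
    using keys_mult[of x y] unfolding carrier_mpoly_ring_iff mpoly_ring_sel by blast
next
  fix x :: "'a mpoly"
  assume "x \<in> carrier (mpoly_ring V)"
  then have "- x \<in> carrier (mpoly_ring V)"
    by (simp add: carrier_mpoly_ring_iff in_keys_iff)
  then show "\<exists>y\<in>carrier (mpoly_ring V). y \<oplus>\<^bsub>mpoly_ring V\<^esub> x = \<zero>\<^bsub>mpoly_ring V\<^esub>"
    by (intro bexI[of _ "- x"]) (simp_all add: mpoly_ring_sel)
qed (simp_all add: mpoly_ring_sel carrier_mpoly_ring_iff algebra_simps)

lemma const_in_mpoly_ring: "mpoly_const c \<in> carrier (mpoly_ring V)"
  by (auto simp: carrier_mpoly_ring_iff mpoly_const_def)

section \<open>Monomial parametrisations by two variables\<close>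

text \<open>If x_i is sent to a monomial containing a target variable with exponent
  \<open>a i\<close>, this is the exponent of that variable in the image of the monomial
  \<open>t\<close>.\<close>

definition weight :: "(nat \<Rightarrow> nat) \<Rightarrow> (nat \<Rightarrow>\<^sub>0 nat) \<Rightarrow> nat" where
  "weight a t = (\<Sum>i\<in>Poly_Mapping.keys t. Poly_Mapping.lookup t i * a i)"

text \<open>As an exponent vector this is u^x v^y in the target ring K[u,v].\<close>

definition bimonom :: "nat \<Rightarrow> nat \<Rightarrow> (nat \<Rightarrow>\<^sub>0 nat)" where
  "bimonom x y = Poly_Mapping.single 0 x + Poly_Mapping.single 1 y"

lemma bimonom_eq_iff: "bimonom x y = bimonom x' y' \<longleftrightarrow> x = x' \<and> y = y'"
proof
  assume eq: "bimonom x y = bimonom x' y'"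
  have "Poly_Mapping.lookup (bimonom a b) 0 = a" "Poly_Mapping.lookup (bimonom a b) 1 = b" for a b
    by (simp_all add: bimonom_def lookup_add lookup_single)
  with eq show "x = x' \<and> y = y'"
    by metis
qed auto

lemma bimonom_add: "bimonom x y + bimonom x' y' = bimonom (x + x') (y + y')"
  by (simp add: bimonom_def single_add algebra_simps)

lemma keys_bimonom: "Poly_Mapping.keys (bimonom x y) \<subseteq> {0, 1}"
  unfolding bimonom_def by (rule order.trans[OF keys_add]) auto

lemma single_bimonom_power:
  "Poly_Mapping.single (bimonom x y) (1::'a::comm_ring_1) ^ k =
     Poly_Mapping.single (bimonom (k * x) (k * y)) 1"
proof (induction k)
  case 0
  then show ?case by (simp add: bimonom_def)
qed (simp add: mult_single bimonom_add)

lemma mpoly_subst_bimonom: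
  fixes c :: "'a::comm_ring_1"
  assumes "\<And>i. i \<in> Poly_Mapping.keys t \<Longrightarrow> g i = Poly_Mapping.single (bimonom (a i) (b i)) 1"
  shows "mpoly_subst g (Poly_Mapping.single t c) =
    Poly_Mapping.single (bimonom (weight a t) (weight b t)) c"
proof -
  have "(\<Prod>i\<in>A. Poly_Mapping.single (bimonom (a i) (b i)) (1::'a) ^ l i) =
      Poly_Mapping.single (bimonom (\<Sum>i\<in>A. l i * a i) (\<Sum>i\<in>A. l i * b i)) 1" if "finite A" for A l
    using that by (induction A)
      (simp_all add: single_bimonom_power mult_single bimonom_add, simp add: bimonom_def)
  then show ?thesis
    using assms by (simp add: mpoly_subst_single weight_def mpoly_const_def mult_single)
qed

lemma mpoly_subst_sum: "mpoly_subst g (sum f A) = (\<Sum>a\<in>A. mpoly_subst g (f a))"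
  by (induction A rule: infinite_finite_induct) (auto simp: mpoly_subst_add)

text \<open>Only an inclusion, since terms with equal image monomials may cancel. It places images
  in K[u,v] and later detects a monomial whose image is new.\<close>

lemma mpoly_subst_bimonom_keys:
  fixes p :: "'a::comm_ring_1 mpoly"
  assumes "\<And>i. i \<in> V \<Longrightarrow> g i = Poly_Mapping.single (bimonom (a i) (b i)) 1"
    and "p \<in> carrier (mpoly_ring V)"
  shows "Poly_Mapping.keys (mpoly_subst g p) \<subseteq>
    (\<lambda>t. bimonom (weight a t) (weight b t)) ` Poly_Mapping.keys p"
proof -
  let ?c = "Poly_Mapping.lookup p"
  have "mpoly_subst g p = (\<Sum>t\<in>Poly_Mapping.keys p. mpoly_subst g (Poly_Mapping.single t (?c t)))"
    by (subst poly_mapping_sum_singles[of p]) (rule mpoly_subst_sum)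
  also have "\<dots> = (\<Sum>t\<in>Poly_Mapping.keys p.
      Poly_Mapping.single (bimonom (weight a t) (weight b t)) (?c t))"
    using assms by (intro sum.cong refl mpoly_subst_bimonom) (auto simp: carrier_mpoly_ring_iff)
  finally show ?thesis
    using keys_sum_subset[of "\<lambda>t. Poly_Mapping.single (bimonom (weight a t) (weight b t)) (?c t)"
        "Poly_Mapping.keys p"] by auto
qed

lemma ring_hom_mpoly_subst:
  fixes g :: "nat \<Rightarrow> 'a::comm_ring_1 mpoly"
  assumes "\<And>i. i \<in> V \<Longrightarrow> g i = Poly_Mapping.single (bimonom (a i) (b i)) 1"
  shows "ring_hom_ring (mpoly_ring V) (mpoly_ring {0, 1}) (mpoly_subst g)"
proof (intro ring_hom_ringI2 ring_hom_memI)
  fix p :: "'a mpoly"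
  assume "p \<in> carrier (mpoly_ring V)"
  then show "mpoly_subst g p \<in> carrier (mpoly_ring {0, 1})"
    using mpoly_subst_bimonom_keys[of V g a b p] assms keys_bimonom
    unfolding carrier_mpoly_ring_iff by blast
qed (auto simp: mpoly_ring_sel mpoly_subst_mult mpoly_subst_add mpoly_subst_1
    intro: cring.axioms(1) cring_mpoly_ring)

section \<open>Dimensions of graded components modulo the kernel\<close>

text \<open>Dimensions are taken over a subfield of the quotient ring. The constants give a ring
  homomorphism from K, and \<open>1 \<notin> I\<close> makes the quotient nonzero, so the image of
  the field K is a subfield.\<close>

lemma subfield_const:
  fixes I :: "'a::field mpoly set"
  assumes I: "ideal I (mpoly_ring V)" and "1 \<notin> I"
  shows "subfield (range (\<lambda>c. I +>\<^bsub>mpoly_ring V\<^esub> mpoly_const c)) (mpoly_ring V Quot I)"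
proof -
  let ?R = "mpoly_ring V :: 'a mpoly ring"
  \<comment> \<open>The field K itself as a record, so that results on ring homomorphisms apply to
    \<open>mpoly_const\<close>.\<close>
  let ?K = "\<lparr>carrier = UNIV, mult = (*), one = 1, zero = 0, add = (+)\<rparr> :: 'a ring"
  have cring: "cring ?K"
  proof (rule cringI)
    show "abelian_group ?K"
    proof (rule abelian_groupI)
      fix x assume "x \<in> carrier ?K"
      show "\<exists>y\<in>carrier ?K. y \<oplus>\<^bsub>?K\<^esub> x = \<zero>\<^bsub>?K\<^esub>"
        by (intro bexI[of _ "- x"]) simp_all
    qed (simp_all add: add_ac)
    show "comm_monoid ?K"
      by (rule comm_monoidI) auto
  qed (auto simp: algebra_simps)
  then have field: "field ?K"
  proof (rule cring.field_intro2)
    fix x assume "x \<in> carrier ?K - {\<zero>\<^bsub>?K\<^esub>}"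
    then show "x \<in> Units ?K"
      by (auto simp: Units_def intro!: exI[of _ "inverse x"])
  qed simp
  have ring: "ring ?K"
    using cring by (rule cring.axioms)
  have "(\<lambda>c. I +>\<^bsub>?R\<^esub> mpoly_const c) \<in> ring_hom ?K (?R Quot I)"
  proof -
    have "mpoly_const \<in> ring_hom ?K ?R"
      by (rule ring_hom_memI)
        (auto simp: mpoly_const_add mpoly_const_mult mpoly_ring_sel const_in_mpoly_ring,
          simp add: mpoly_const_def)
    from ring_hom_trans[OF this ideal.rcos_ring_hom[OF I]] show ?thesis
      by (simp add: comp_def)
  qed
  then have hom: "ring_hom_ring ?K (?R Quot I) (\<lambda>c. I +>\<^bsub>?R\<^esub> mpoly_const c)"
    using ring ideal.quotient_is_ring[OF I] by (intro ring_hom_ringI2)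
  have "\<one>\<^bsub>?R Quot I\<^esub> \<noteq> \<zero>\<^bsub>?R Quot I\<^esub>"
  proof
    assume "\<one>\<^bsub>?R Quot I\<^esub> = \<zero>\<^bsub>?R Quot I\<^esub>"
    then have "I +>\<^bsub>?R\<^esub> \<one>\<^bsub>?R\<^esub> = I"
      by (simp add: FactRing_def)
    then have "1 \<in> I"
      using abelian_group.a_coset_join1[OF ring.is_abelian_group[OF cring.axioms(1)[OF cring_mpoly_ring]]
          _ monoid.one_closed additive_subgroup.a_subgroup[OF ideal.axioms(1)[OF I]]]
        ring.is_monoid[OF cring.axioms(1)[OF cring_mpoly_ring]]
      by (metis mpoly_ring_sel(2))
    with \<open>1 \<notin> I\<close> show False ..
  qed
  with ring_hom_ring.img_is_subfield(2)[OF hom field.carrier_is_subfield[OF field]]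
  show ?thesis
    by simp
qed

text \<open>Induction on \<open>M\<close>. A monomial \<open>t\<close> with the same image as some
  \<open>s\<close> in \<open>M\<close> adds no class, since c t and c s are congruent. Otherwise its
  image is a monomial absent from all images of polynomials supported on \<open>M\<close>, and its
  class raises the dimension by one. So the dimension counts distinct image monomials.\<close>

lemma dimension_coset_image:
  fixes g :: "nat \<Rightarrow> 'a::field mpoly"
  assumes g: "\<And>i. i \<in> V \<Longrightarrow> g i = Poly_Mapping.single (bimonom (a i) (b i)) 1"
    and "finite M" and "\<And>t. t \<in> M \<Longrightarrow> Poly_Mapping.keys t \<subseteq> V"
  defines "I \<equiv> a_kernel (mpoly_ring V) (mpoly_ring {0, 1}) (mpoly_subst g)"
  shows "ring.dimension (mpoly_ring V Quot I) (card ((\<lambda>t. (weight a t, weight b t)) ` M))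
    (range (\<lambda>c. I +>\<^bsub>mpoly_ring V\<^esub> mpoly_const c))
    ((\<lambda>p. I +>\<^bsub>mpoly_ring V\<^esub> p) ` {p. Poly_Mapping.keys p \<subseteq> M})"
proof -
  interpret hom: ring_hom_ring "mpoly_ring V" "mpoly_ring {0, 1}" "mpoly_subst g"
    using g by (rule ring_hom_mpoly_subst)
  have I: "ideal I (mpoly_ring V)"
    unfolding I_def by (rule hom.kernel_is_ideal)
  interpret Q: ring "mpoly_ring V Quot I"
    using I by (rule ideal.quotient_is_ring)
  interpret pi: ring_hom_ring "mpoly_ring V" "mpoly_ring V Quot I" "\<lambda>p. I +>\<^bsub>mpoly_ring V\<^esub> p"
    using I by (rule ideal.rcos_ring_hom_ring)
  show ?thesis
    using assms(2,3)
  proof (induction M)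
    case empty
    have "{p :: 'a mpoly. Poly_Mapping.keys p \<subseteq> {}} = {\<zero>\<^bsub>mpoly_ring V\<^esub>}"
      by (auto simp: mpoly_ring_sel)
    then show ?case
      using Q.zero_dim pi.hom_zero by simp
  next
    case (insert t M)
    let ?\<pi> = "\<lambda>p. I +>\<^bsub>mpoly_ring V\<^esub> p" and ?w = "\<lambda>t. (weight a t, weight b t)"
    let ?E = "\<lambda>M. {p :: 'a mpoly. Poly_Mapping.keys p \<subseteq> M}"
    let ?K = "range (\<lambda>c. ?\<pi> (mpoly_const c))"
    have E_carrier: "?E (insert t M) \<subseteq> carrier (mpoly_ring V)"
    proof
      fix p assume "p \<in> ?E (insert t M)"
      then have "Poly_Mapping.keys s \<subseteq> V" if "s \<in> Poly_Mapping.keys p" for s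
        using that insert.prems[of s] by auto
      then show "p \<in> carrier (mpoly_ring V)"
        by (simp add: carrier_mpoly_ring_iff)
    qed
    \<comment> \<open>Modulo the kernel, classes are compared through their images under the
      substitution.\<close>
    have pi_eq_iff: "?\<pi> p = ?\<pi> q \<longleftrightarrow> mpoly_subst g p = mpoly_subst g q"
      if "p \<in> ?E (insert t M)" "q \<in> ?E (insert t M)" for p q
      using that E_carrier unfolding I_def by (subst (1 2) hom.rcos_eq_homeq) auto
    have split: "\<exists>c q. q \<in> ?E M \<and> p = Poly_Mapping.single t c + q" if "p \<in> ?E (insert t M)" for p
    proof (intro exI conjI)
      show "p = Poly_Mapping.single t (Poly_Mapping.lookup p t) +
          (p - Poly_Mapping.single t (Poly_Mapping.lookup p t))"
        by simp
      show "p - Poly_Mapping.single t (Poly_Mapping.lookup p t) \<in> ?E M"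
        using that by (auto simp: in_keys_iff lookup_minus lookup_single when_def split: if_splits)
    qed
    have single_add_E: "Poly_Mapping.single t c + q \<in> ?E (insert s M)"
      if "q \<in> ?E M" "t \<in> insert s M" for c q t s
      using that keys_add[of "Poly_Mapping.single t c" q] by (auto split: if_splits)
    have subst: "mpoly_subst g (Poly_Mapping.single s c) = Poly_Mapping.single (bimonom (weight a s) (weight b s)) c"
      if "s \<in> insert t M" for s c
      using that insert.prems g by (intro mpoly_subst_bimonom) auto
    have IH: "Q.dimension (card (?w ` M)) ?K (?\<pi> ` ?E M)"
      using insert by simp
    show ?case
    proof (cases "?w t \<in> ?w ` M")
      case True
      then obtain s where s: "s \<in> M" "?w t = ?w s"
        by auto
      have "?\<pi> ` ?E (insert t M) = ?\<pi> ` ?E M"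
      proof
        show "?\<pi> ` ?E (insert t M) \<subseteq> ?\<pi> ` ?E M"
        proof
          fix x assume "x \<in> ?\<pi> ` ?E (insert t M)"
          then obtain c q where q: "q \<in> ?E M" and x: "x = ?\<pi> (Poly_Mapping.single t c + q)"
            using split by blast
          have "x = ?\<pi> (Poly_Mapping.single s c + q)"
            unfolding x using q s single_add_E[of q]
            by (subst pi_eq_iff) (auto simp: mpoly_subst_add subst)
          moreover have "Poly_Mapping.single s c + q \<in> ?E M"
            using single_add_E[OF q, of s s c] s by (simp add: insert_absorb)
          ultimately show "x \<in> ?\<pi> ` ?E M"
            by blast
        qed
      qed auto
      with IH True show ?thesis
        by (simp add: insert_absorb)
    next
      case False
      let ?v = "Poly_Mapping.single t 1 :: 'a mpoly"
      have v: "?v \<in> ?E (insert t M)"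
        using single_add_E[of 0 t t 1] by simp
      have "?\<pi> ?v \<notin> ?\<pi> ` ?E M"
      proof
        assume "?\<pi> ?v \<in> ?\<pi> ` ?E M"
        then obtain q where q: "q \<in> ?E M" "?\<pi> ?v = ?\<pi> q"
          by auto
        then have "mpoly_subst g q = mpoly_subst g ?v"
          using v pi_eq_iff[of ?v q] subset_insertI2[of _ M t] by simp
        then have "bimonom (weight a t) (weight b t) \<in> Poly_Mapping.keys (mpoly_subst g q)"
          by (simp add: subst)
        then have "bimonom (weight a t) (weight b t) \<in> (\<lambda>t. bimonom (weight a t) (weight b t)) ` M"
          using mpoly_subst_bimonom_keys[of V g a b q] g q E_carrier by blast
        with False show False
          by (auto simp: bimonom_eq_iff)
      qed
      moreover have "Q.line_extension ?K (?\<pi> ?v) (?\<pi> ` ?E M) = ?\<pi> ` ?E (insert t M)"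
      proof -
        have *: "?\<pi> (mpoly_const c) \<otimes>\<^bsub>mpoly_ring V Quot I\<^esub> ?\<pi> ?v \<oplus>\<^bsub>mpoly_ring V Quot I\<^esub> ?\<pi> q
            = ?\<pi> (Poly_Mapping.single t c + q)" if "q \<in> ?E M" for c q
        proof -
          have "q \<in> carrier (mpoly_ring V)" "?v \<in> carrier (mpoly_ring V)"
            using that v E_carrier by auto
          moreover have "mpoly_const c \<otimes>\<^bsub>mpoly_ring V\<^esub> ?v \<oplus>\<^bsub>mpoly_ring V\<^esub> q = Poly_Mapping.single t c + q"
            by (simp add: mpoly_ring_sel mpoly_const_def mult_single)
          ultimately show ?thesis
            using const_in_mpoly_ring[of c V]
            by (metis pi.hom_add pi.hom_mult hom.R.m_closed)
        qed
        show ?thesis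
        proof (rule equalityI; rule subsetI)
          fix x assume "x \<in> Q.line_extension ?K (?\<pi> ?v) (?\<pi> ` ?E M)"
          then obtain c q where "q \<in> ?E M" "x = ?\<pi> (Poly_Mapping.single t c + q)"
            unfolding Q.line_extension_mem_iff using * by auto
          then show "x \<in> ?\<pi> ` ?E (insert t M)"
            using single_add_E[of q t t c] by blast
        next
          fix x assume "x \<in> ?\<pi> ` ?E (insert t M)"
          then obtain c q where "q \<in> ?E M" "x = ?\<pi> (Poly_Mapping.single t c + q)"
            using split by blast
          then show "x \<in> Q.line_extension ?K (?\<pi> ?v) (?\<pi> ` ?E M)"
            unfolding Q.line_extension_mem_iff using * by blast
        qed
      qed
      moreover have "?\<pi> ?v \<in> carrier (mpoly_ring V Quot I)"
        using v E_carrier by (intro pi.hom_closed) auto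
      ultimately have "Q.dimension (Suc (card (?w ` M))) ?K (?\<pi> ` ?E (insert t M))"
        using Q.Suc_dim[OF _ _ IH, of "?\<pi> ?v"] by simp
      with False insert.hyps show ?thesis
        by simp
    qed
  qed
qed

text \<open>The forms of degree \<open>s\<close> are the polynomials supported on the monomials of
  degree \<open>s\<close>, so \<open>dimension_coset_image\<close> applies; 1 is not in the kernel
  because it is sent to 1.\<close>

lemma hilbert_function_bimonom:
  fixes g :: "nat \<Rightarrow> 'a::field mpoly"
  assumes g: "\<And>i. i \<in> V \<Longrightarrow> g i = Poly_Mapping.single (bimonom (a i) (b i)) 1"
    and fin: "finite {t. Poly_Mapping.keys t \<subseteq> V \<and> monom_degree t = s}"
  shows "hilbert_function V (a_kernel (mpoly_ring V) (mpoly_ring {0, 1}) (mpoly_subst g)) s =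
    card ((\<lambda>t. (weight a t, weight b t)) ` {t. Poly_Mapping.keys t \<subseteq> V \<and> monom_degree t = s})"
proof -
  let ?M = "{t. Poly_Mapping.keys t \<subseteq> V \<and> monom_degree t = s}"
  let ?I = "a_kernel (mpoly_ring V) (mpoly_ring {0, 1}) (mpoly_subst g)"
  interpret hom: ring_hom_ring "mpoly_ring V" "mpoly_ring {0, 1}" "mpoly_subst g"
    using g by (rule ring_hom_mpoly_subst)
  have I: "ideal ?I (mpoly_ring V)"
    by (rule hom.kernel_is_ideal)
  have "(\<forall>t\<in>A. Poly_Mapping.keys t \<subseteq> V) \<and> (\<forall>t\<in>A. monom_degree t = s) \<longleftrightarrow> A \<subseteq> ?M" for A
    unfolding subset_eq[of A] Ball_def mem_Collect_eq by blast
  then have part: "homogeneous_part V s = {p :: 'a mpoly. Poly_Mapping.keys p \<subseteq> ?M}"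
    unfolding homogeneous_part_def carrier_mpoly_ring_iff by simp
  have "1 \<notin> ?I"
    unfolding a_kernel_def' mpoly_ring_sel mem_Collect_eq mpoly_subst_1 using one_neq_zero by blast
  from ring.dimI[OF ideal.quotient_is_ring[OF I] subfield_const[OF I this]
      dimension_coset_image[of V g a b, OF g fin]]
  show ?thesis
    unfolding hilbert_function_def part over_def by blast
qed

section \<open>The Hilbert function of a curve as a count of values\<close>

text \<open>These are the exponents of u in degree \<open>s\<close>: \<open>c i\<close> is the
  exponent of x_i, and the degree missing from \<open>s\<close> is left to x_(n+1), whose image has
  no u.\<close>

definition bounded_combinations :: "nat set \<Rightarrow> (nat \<Rightarrow> nat) \<Rightarrow> nat \<Rightarrow> nat set" where
  "bounded_combinations A m s = {\<Sum>i\<in>A. c i * m i | c. (\<Sum>i\<in>A. c i) \<le> s}"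

lemma curve_param_eq:
  "curve_param n m i =
    Poly_Mapping.single (bimonom (if i = n + 1 then 0 else m i) (if i = n + 1 then m n else m n - m i)) 1"
proof -
  have "mpoly_var 0 = (Poly_Mapping.single (bimonom 1 0) 1 :: 'a mpoly)"
    "mpoly_var 1 = (Poly_Mapping.single (bimonom 0 1) 1 :: 'a mpoly)"
    by (simp_all add: mpoly_var_def bimonom_def)
  then have "mpoly_var 0 ^ x * mpoly_var 1 ^ y = (Poly_Mapping.single (bimonom x y) 1 :: 'a mpoly)" for x y
    by (simp add: single_bimonom_power mult_single bimonom_add)
  from this[of 0] this show ?thesis
    by (simp add: curve_param_def)
qed

lemma weight_superset:
  assumes "Poly_Mapping.keys t \<subseteq> V" "finite V"
  shows "weight a t = (\<Sum>i\<in>V. Poly_Mapping.lookup t i * a i)"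
  unfolding weight_def using assms by (intro sum.mono_neutral_left) (auto simp: in_keys_iff)

lemma monom_degree_superset:
  assumes "Poly_Mapping.keys t \<subseteq> V" "finite V"
  shows "monom_degree t = (\<Sum>i\<in>V. Poly_Mapping.lookup t i)"
  unfolding monom_degree_def using assms by (intro sum.mono_neutral_left) (auto simp: in_keys_iff)

lemma finite_monoms:
  assumes "finite V"
  shows "finite {t. Poly_Mapping.keys t \<subseteq> V \<and> monom_degree t = s}"
proof (rule inj_on_finite)
  show "inj_on Poly_Mapping.lookup {t. Poly_Mapping.keys t \<subseteq> V \<and> monom_degree t = s}"
    by (rule inj_onI, rule poly_mapping_eqI) simp
  show "Poly_Mapping.lookup ` {t. Poly_Mapping.keys t \<subseteq> V \<and> monom_degree t = s} \<subseteq>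
      {f. \<forall>i. (i \<in> V \<longrightarrow> f i \<in> {..s}) \<and> (i \<notin> V \<longrightarrow> f i = 0)}"
  proof (rule image_subsetI, intro CollectI allI conjI impI)
    fix t i assume t: "t \<in> {t. Poly_Mapping.keys t \<subseteq> V \<and> monom_degree t = s}"
    show "Poly_Mapping.lookup t i \<in> {..s}" if "i \<in> V"
    proof -
      have "Poly_Mapping.lookup t i \<le> (\<Sum>i\<in>V. Poly_Mapping.lookup t i)"
        using that assms by (intro member_le_sum) auto
      then show ?thesis
        using t monom_degree_superset[of t V] assms by simp
    qed
    show "Poly_Mapping.lookup t i = 0" if "i \<notin> V"
      using t that by (simp add: subset_iff in_keys_iff) blast
  qed
  show "finite {f. \<forall>i. (i \<in> V \<longrightarrow> f i \<in> {..s}) \<and> (i \<notin> V \<longrightarrow> f i = (0::nat))}"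
    using assms by (intro finite_set_of_finite_funs) auto
qed

text \<open>Every variable is sent to a form of degree \<open>m n\<close>. In degree
  \<open>s\<close> the exponents of u and v thus add up to \<open>s * m n\<close>, and the exponent
  of u alone determines the image monomial.\<close>

lemma hilbert_function_curve:
  assumes "k \<le> n" and le: "\<And>i. i \<in> {k..n} \<Longrightarrow> m i \<le> m n"
  shows "hilbert_function {k..n+1} (curve_ideal k n m :: 'a::field mpoly set) s =
    card (bounded_combinations {k..n} m s)"
proof -
  let ?a = "\<lambda>i. if i = n + 1 then 0 else m i" and ?b = "\<lambda>i. if i = n + 1 then m n else m n - m i"
  let ?M = "{t. Poly_Mapping.keys t \<subseteq> {k..n+1} \<and> monom_degree t = s}"
  have sum_split: "(\<Sum>i\<in>{k..n+1}. f i) = (\<Sum>i\<in>{k..n}. f i) + f (n + 1)" for f :: "nat \<Rightarrow> nat"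
    using \<open>k \<le> n\<close> by simp
  have a: "weight ?a t = (\<Sum>i\<in>{k..n}. Poly_Mapping.lookup t i * m i)" if "t \<in> ?M" for t
    using that weight_superset[of t "{k..n+1}" ?a, unfolded sum_split] by simp
  have deg: "(\<Sum>i\<in>{k..n}. Poly_Mapping.lookup t i) + Poly_Mapping.lookup t (n + 1) = s" if "t \<in> ?M" for t
    using that monom_degree_superset[of t "{k..n+1}", unfolded sum_split] by simp
  have ab: "weight ?a t + weight ?b t = s * m n" if "t \<in> ?M" for t
  proof -
    have "weight ?a t + weight ?b t = (\<Sum>i\<in>{k..n+1}. Poly_Mapping.lookup t i * (?a i + ?b i))"
      using that weight_superset[of t "{k..n+1}"] by (simp add: sum.distrib distrib_left)
    also have "\<dots> = (\<Sum>i\<in>{k..n+1}. Poly_Mapping.lookup t i * m n)"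
    proof (intro sum.cong refl)
      \<comment> \<open>Because \<open>m i \<le> m n\<close>, the truncated difference is exact and
        each variable contributes \<open>m n\<close>.\<close>
      fix i assume "i \<in> {k..n+1}"
      then show "Poly_Mapping.lookup t i * (?a i + ?b i) = Poly_Mapping.lookup t i * m n"
        using le[of i] by (cases "i = n + 1") auto
    qed
    also have "\<dots> = s * m n"
      using that monom_degree_superset[of t "{k..n+1}"] by (simp flip: sum_distrib_right)
    finally show ?thesis .
  qed
  have "hilbert_function {k..n+1} (curve_ideal k n m :: 'a mpoly set) s =
      card ((\<lambda>t. (weight ?a t, weight ?b t)) ` ?M)"
    unfolding curve_ideal_def
    by (rule hilbert_function_bimonom[OF curve_param_eq]) (rule finite_monoms, simp)
  also have "(\<lambda>t. (weight ?a t, weight ?b t)) ` ?M = (\<lambda>x. (x, s * m n - x)) ` weight ?a ` ?M"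
    unfolding image_image
  proof (rule image_cong[OF refl])
    fix t assume "t \<in> ?M"
    from ab[OF this] show "(weight ?a t, weight ?b t) = (weight ?a t, s * m n - weight ?a t)"
      by simp
  qed
  also have "card \<dots> = card (weight ?a ` ?M)"
    by (rule card_image) (auto intro: inj_onI)
  also have "weight ?a ` ?M = bounded_combinations {k..n} m s"
  proof (rule equalityI; rule subsetI)
    fix x assume "x \<in> weight ?a ` ?M"
    then obtain t where t: "t \<in> ?M" "x = weight ?a t"
      by blast
    have "x = (\<Sum>i\<in>{k..n}. Poly_Mapping.lookup t i * m i)"
      unfolding t(2) by (rule a[OF t(1)])
    moreover have "(\<Sum>i\<in>{k..n}. Poly_Mapping.lookup t i) \<le> s"
      using deg[OF t(1)] by linarith
    ultimately show "x \<in> bounded_combinations {k..n} m s"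
      unfolding bounded_combinations_def by blast
  next
    fix x assume "x \<in> bounded_combinations {k..n} m s"
    then obtain c where c: "x = (\<Sum>i\<in>{k..n}. c i * m i)" "(\<Sum>i\<in>{k..n}. c i) \<le> s"
      by (auto simp: bounded_combinations_def)
    \<comment> \<open>The last variable takes up the degree missing from \<open>s\<close> without
      changing the exponent of u.\<close>
    define f where "f i = (if i \<in> {k..n} then c i else if i = n + 1 then s - (\<Sum>i\<in>{k..n}. c i) else 0)" for i
    define t where "t = Abs_poly_mapping f"
    have "finite {i. f i \<noteq> 0}"
      by (rule finite_subset[of _ "{k..n+1}"]) (use \<open>k \<le> n\<close> in \<open>auto simp: f_def split: if_splits\<close>)
    then have t: "Poly_Mapping.lookup t = f"
      unfolding t_def by simp
    have keys: "Poly_Mapping.keys t \<subseteq> {k..n+1}"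
    proof
      fix i assume "i \<in> Poly_Mapping.keys t"
      then have "f i \<noteq> 0"
        by (simp add: in_keys_iff t)
      then show "i \<in> {k..n+1}"
        using \<open>k \<le> n\<close> unfolding f_def by (auto split: if_splits)
    qed
    have "(\<Sum>i\<in>{k..n}. f i) = (\<Sum>i\<in>{k..n}. c i)" "(\<Sum>i\<in>{k..n}. f i * m i) = x"
      unfolding c(1) by (intro sum.cong refl; simp add: f_def)+
    moreover have "f (n + 1) = s - (\<Sum>i\<in>{k..n}. c i)"
      by (simp add: f_def)
    ultimately have "monom_degree t = s"
      using monom_degree_superset[OF keys, unfolded sum_split t] c(2) by simp
    with keys have M: "t \<in> ?M"
      by simp
    moreover have "weight ?a t = x"
      unfolding a[OF M] t by fact
    ultimately show "x \<in> weight ?a ` ?M"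
      by blast
  qed
  finally show ?thesis .
qed

section \<open>The semigroup of the curve\<close>

text \<open>Greedy induction: the next index is as large as \<open>b\<close> allows while at least
  \<open>a * N\<close> remains for the other \<open>N\<close> indices.\<close>

lemma exists_sum_coeffs:
  assumes "a \<le> b" "a * N \<le> T" "T \<le> b * N"
  shows "\<exists>c. (\<Sum>i\<in>{a..b}. c i) = N \<and> (\<Sum>i\<in>{a..b}. c i * i) = (T::nat)"
  using assms(2,3)
proof (induction N arbitrary: T)
  case 0
  then show ?case
    by (intro exI[of _ "\<lambda>_. 0"]) simp
next
  case (Suc N)
  define i where "i = min b (T - a * N)"
  have i: "i \<in> {a..b}" "a * N \<le> T - i" "T - i \<le> b * N" "i \<le> T"
    using Suc.prems \<open>a \<le> b\<close> mult_le_mono1[OF \<open>a \<le> b\<close>, of N] by (auto simp: i_def min_def)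
  from Suc.IH[OF i(2,3)] obtain c
    where c: "(\<Sum>i\<in>{a..b}. c i) = N" "(\<Sum>i\<in>{a..b}. c i * i) = T - i"
    by blast
  have "(\<Sum>l\<in>{a..b}. (c l + (if l = i then 1 else 0)) * l) = T"
    using i c(2) by (simp add: distrib_right sum.distrib if_distrib[of "\<lambda>x. x * _"] cong: if_cong)
  moreover have "(\<Sum>l\<in>{a..b}. c l + (if l = i then 1 else 0)) = Suc N"
    using i c(1) by (simp add: sum.distrib)
  ultimately show ?case
    by blast
qed

text \<open>The value depends only on the number \<open>N\<close> of summands and the total
  \<open>T\<close> of the offsets \<open>i - 1\<close>, and every \<open>T\<close> between the
  extremes occurs. Coefficient vectors are thereby replaced by pairs (N, T).\<close>

lemma exists_sum_arith_progression:
  fixes h p e :: nat and m :: "nat \<Rightarrow> nat"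
  assumes m: "\<And>i. i \<in> {a..n} \<Longrightarrow> m i = h * (p + (i - 1) * e)" and a: "1 \<le> a" "a \<le> n"
  shows "(\<exists>c. (\<Sum>i\<in>{a..n}. c i) = N \<and> x = (\<Sum>i\<in>{a..n}. c i * m i)) \<longleftrightarrow>
    (\<exists>T. x = h * (N * p + T * e) \<and> (a - 1) * N \<le> T \<and> T \<le> (n - 1) * N)"
proof -
  have val: "(\<Sum>i\<in>{a..n}. c i * m i) = h * ((\<Sum>i\<in>{a..n}. c i) * p + (\<Sum>i\<in>{a..n}. c i * (i - 1)) * e)" for c
  proof -
    have "(\<Sum>i\<in>{a..n}. c i * m i) = (\<Sum>i\<in>{a..n}. h * (c i * p + c i * (i - 1) * e))"
      by (intro sum.cong refl) (simp add: m algebra_simps)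
    then show ?thesis
      by (simp add: sum.distrib sum_distrib_left sum_distrib_right distrib_left)
  qed
  show ?thesis
  proof
    assume "\<exists>c. (\<Sum>i\<in>{a..n}. c i) = N \<and> x = (\<Sum>i\<in>{a..n}. c i * m i)"
    then obtain c where c: "(\<Sum>i\<in>{a..n}. c i) = N" "x = (\<Sum>i\<in>{a..n}. c i * m i)"
      by blast
    have "(\<Sum>i\<in>{a..n}. c i * (a - 1)) \<le> (\<Sum>i\<in>{a..n}. c i * (i - 1))"
      "(\<Sum>i\<in>{a..n}. c i * (i - 1)) \<le> (\<Sum>i\<in>{a..n}. c i * (n - 1))"
      by (intro sum_mono mult_le_mono; auto intro: diff_le_mono)+
    then have "(a - 1) * N \<le> (\<Sum>i\<in>{a..n}. c i * (i - 1))" "(\<Sum>i\<in>{a..n}. c i * (i - 1)) \<le> (n - 1) * N"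
      by (simp_all only: c(1) mult.commute[of _ N] flip: sum_distrib_right)
    with c(2) show "\<exists>T. x = h * (N * p + T * e) \<and> (a - 1) * N \<le> T \<and> T \<le> (n - 1) * N"
      unfolding val c(1) by blast
  next
    assume "\<exists>T. x = h * (N * p + T * e) \<and> (a - 1) * N \<le> T \<and> T \<le> (n - 1) * N"
    then obtain T where T: "x = h * (N * p + T * e)" "(a - 1) * N \<le> T" "T \<le> (n - 1) * N"
      by blast
    have "a * N = (a - 1) * N + N" "n * N = (n - 1) * N + N"
      using a by (cases a; cases n; simp)+
    \<comment> \<open>\<open>exists_sum_coeffs\<close> speaks of indices, whose total exceeds that
      of the offsets by \<open>N\<close>.\<close>
    with T have "a * N \<le> T + N" "T + N \<le> n * N"
      by linarith+
    from exists_sum_coeffs[OF a(2) this] obtain c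
      where c: "(\<Sum>i\<in>{a..n}. c i) = N" "(\<Sum>i\<in>{a..n}. c i * i) = T + N"
      by blast
    have "(\<Sum>i\<in>{a..n}. c i * i) = (\<Sum>i\<in>{a..n}. c i * (i - 1) + c i)"
    proof (intro sum.cong refl)
      fix i assume "i \<in> {a..n}"
      with a show "c i * i = c i * (i - 1) + c i"
        by (cases i) auto
    qed
    with c have "(\<Sum>i\<in>{a..n}. c i * (i - 1)) = T"
      by (simp add: sum.distrib)
    with c show "\<exists>c. (\<Sum>i\<in>{a..n}. c i) = N \<and> x = (\<Sum>i\<in>{a..n}. c i * m i)"
      unfolding val T(1) by blast
  qed
qed

lemma bounded_combinations_eq:
  "bounded_combinations A m s = {x. \<exists>N\<le>s. \<exists>c. (\<Sum>i\<in>A. c i) = N \<and> x = (\<Sum>i\<in>A. c i * m i)}"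
  unfolding bounded_combinations_def by blast

lemma nat_combinations_eq:
  "nat_combinations A m = {x. \<exists>N c. (\<Sum>i\<in>A. c i) = N \<and> x = (\<Sum>i\<in>A. c i * m i)}"
  unfolding nat_combinations_def by blast

text \<open>The multiplicity of \<open>m 1\<close> is split off because, for the curve, only the
  terms from index 2 on form an arithmetic sequence.\<close>

lemma bounded_combinations_from_1:
  assumes "1 \<le> (n::nat)"
  shows "bounded_combinations {1..n} m s = {q * m 1 + x | q N x. q + N \<le> s \<and>
    (\<exists>c. (\<Sum>i\<in>{2..n}. c i) = N \<and> x = (\<Sum>i\<in>{2..n}. c i * m i))}"
proof -
  have split: "(\<Sum>i\<in>{1..n}. f i) = f 1 + (\<Sum>i\<in>{2..n}. f i)" for f :: "nat \<Rightarrow> nat"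
    using sum.atLeast_Suc_atMost[OF assms, of f] by (simp add: numeral_2_eq_2)
  show ?thesis
  proof (rule equalityI; rule subsetI)
    fix y assume "y \<in> bounded_combinations {1..n} m s"
    then show "y \<in> {q * m 1 + x | q N x. q + N \<le> s \<and>
        (\<exists>c. (\<Sum>i\<in>{2..n}. c i) = N \<and> x = (\<Sum>i\<in>{2..n}. c i * m i))}"
      unfolding bounded_combinations_def split by blast
  next
    fix y assume "y \<in> {q * m 1 + x | q N x. q + N \<le> s \<and>
        (\<exists>c. (\<Sum>i\<in>{2..n}. c i) = N \<and> x = (\<Sum>i\<in>{2..n}. c i * m i))}"
    then obtain q c where y: "y = q * m 1 + (\<Sum>i\<in>{2..n}. c i * m i)" "q + (\<Sum>i\<in>{2..n}. c i) \<le> s"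
      by blast
    let ?c = "c(1 := q)"
    have "(\<Sum>i\<in>{2..n}. ?c i) = (\<Sum>i\<in>{2..n}. c i)" "(\<Sum>i\<in>{2..n}. ?c i * m i) = (\<Sum>i\<in>{2..n}. c i * m i)"
      by (intro sum.cong refl; simp)+
    with y have "y = (\<Sum>i\<in>{1..n}. ?c i * m i) \<and> (\<Sum>i\<in>{1..n}. ?c i) \<le> s"
      unfolding split by simp
    then show "y \<in> bounded_combinations {1..n} m s"
      unfolding bounded_combinations_def by blast
  qed
qed

lemma hilbert_series_curve:
  assumes "k \<le> n" "\<And>i. i \<in> {k..n} \<Longrightarrow> m i \<le> m n"
  shows "hilbert_series {k..n+1} (curve_ideal k n m :: 'a::field mpoly set) =
    Abs_fps (\<lambda>s. of_nat (card (bounded_combinations {k..n} m s)))"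
proof -
  have "hilbert_function {k..n+1} (curve_ideal k n m :: 'a mpoly set) s =
      card (bounded_combinations {k..n} m s)" for s
    using assms by (rule hilbert_function_curve)
  then show ?thesis
    by (simp only: hilbert_series_def)
qed

section \<open>The power series 1/(1 - t)\<close>

lemma fps_geometric_inverse: "(1 - fps_X) * Abs_fps (\<lambda>_. 1) = (1 :: 'a::comm_ring_1 fps)"
proof (rule fps_ext)
  fix n
  show "fps_nth ((1 - fps_X) * Abs_fps (\<lambda>_. 1)) n = fps_nth (1 :: 'a fps) n"
    by (cases n) (simp_all add: left_diff_distrib)
qed

text \<open>Turns the division in the final formula into a multiplication, leaving identities of a
  commutative ring.\<close>

lemma fps_divide_one_minus_X_squared:
  fixes f :: "'a::field fps"
  shows "f / (1 - fps_X) ^ 2 = f * Abs_fps (\<lambda>_. 1) ^ 2"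
proof -
  have J: "(1 - fps_X) * Abs_fps (\<lambda>_. 1) = (1 :: 'a fps)"
    by (rule fps_geometric_inverse)
  then have "(1 - fps_X :: 'a fps) ^ 2 \<noteq> 0"
    by auto
  moreover have "f * Abs_fps (\<lambda>_. 1) ^ 2 * (1 - fps_X) ^ 2 = f * ((1 - fps_X) * Abs_fps (\<lambda>_. 1)) ^ 2"
    by (simp only: power_mult_distrib mult_ac)
  then have "f * Abs_fps (\<lambda>_. 1) ^ 2 * (1 - fps_X) ^ 2 = f"
    by (simp add: J)
  ultimately show ?thesis
    by (metis nonzero_mult_div_cancel_right)
qed

text \<open>
  Here \<open>p = m\<^sub>1\<close>, \<open>e = d / h\<close> and \<open>r = n - 1\<close>; the values of \<open>m\<^sub>2, \<dots>, m\<^sub>n\<close> are divided by \<open>h\<close>,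
  so that a sum of \<open>N\<close> of them is \<open>N * p + T * e\<close> with \<open>N \<le> T \<le> r * N\<close>. The number \<open>step_bound\<close>
  is \<open>\<delta> / h\<close>.
\<close>

locale curve_semigroup =
  fixes p e r h :: nat
  assumes p: "p > 0" and e: "e > 0" and r: "r \<ge> 2" and h: "h > 0"
    and coprime: "coprime p e"
begin

section \<open>The thresholds \<beta>_j\<close>

definition step_bound where "step_bound = (p - 1) div r + e + 1"

text \<open>The condition of the theorem divided by \<open>h\<close>: j h m_1 + b m_2 becomes
  \<open>(j + b) * p + b * e\<close>, and the offsets of m_3, ..., m_n run from 2 to
  \<open>r\<close>.\<close>

definition \<beta> where
  "\<beta> j = (LEAST b. b > 0 \<and> (\<exists>N T. (j + b) * p + b * e = N * p + T * e \<and> 2 * N \<le> T \<and> T \<le> r * N))"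

text \<open>Clears the floor: for \<open>j < e\<close> both sides hold, and otherwise
  \<open>j - e\<close> is compared with the quotient.\<close>

lemma less_step_bound_iff: "j < step_bound \<longleftrightarrow> r * j < p + r * e"
proof (cases "e \<le> j")
  case True
  then have "j < step_bound \<longleftrightarrow> j - e \<le> (p - 1) div r"
    by (auto simp: step_bound_def)
  also have "\<dots> \<longleftrightarrow> (j - e) * r \<le> p - 1"
    using r by (intro less_eq_div_iff_mult_less_eq) auto
  also have "\<dots> \<longleftrightarrow> r * j < p + r * e"
    using True p by (auto simp: algebra_simps diff_mult_distrib)
  finally show ?thesis .
next
  case False
  then have "r * j \<le> r * e"
    by (intro mult_le_mono2) simp
  then have "r * j < p + r * e"
    using p by linarith
  moreover have "j < step_bound"
    using False by (simp add: step_bound_def)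
  ultimately show ?thesis
    by blast
qed

text \<open>By coprimality the two representations differ by an integer k with T = b + p k and N = j
  + b - i - k e. As \<open>i < j\<close>, the condition \<open>N \<le> T\<close> forces k to be at
  least 1, and \<open>T \<le> r * N\<close> then gives the bound.\<close>

lemma beta_lower:
  assumes eq: "(j + b) * p + b * e = (i + N) * p + T * e"
    and "i < j" "N \<le> T" "T \<le> r * N"
  shows "p + r * e \<le> (r - 1) * b + r * j"
proof -
  have "(int T - int b) * int e = (int j + int b - int i - int N) * int p"
    using eq[THEN arg_cong[of _ _ int]] by (simp add: algebra_simps)
  then have "int p dvd (int T - int b) * int e"
    by simp
  then have "int p dvd int T - int b"
    using coprime by (simp add: coprime_dvd_mult_left_iff)
  then obtain k where k: "int T - int b = int p * k"
    by (elim dvdE)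
  with \<open>(int T - int b) * int e = _\<close> have "int p * (k * int e) = int p * (int j + int b - int i - int N)"
    by (simp add: algebra_simps)
  then have N: "int N = int j + int b - int i - k * int e"
    using p by simp
  have T: "int T = int b + int p * k"
    using k by simp
  have "int j - int i \<le> k * (int p + int e)"
    using \<open>N \<le> T\<close> N T by (simp add: algebra_simps)
  with \<open>i < j\<close> have "0 < k * (int p + int e)"
    by linarith
  then have "k \<ge> 1"
    by (simp add: zero_less_mult_iff)
  have "int T \<le> int r * int N"
    using \<open>T \<le> r * N\<close> by (metis of_nat_le_iff of_nat_mult)
  then have 1: "k * (int p + int r * int e) \<le> (int r - 1) * int b + int r * (int j - int i)"
    unfolding N T by (simp add: algebra_simps)
  have 2: "1 * (int p + int r * int e) \<le> k * (int p + int r * int e)"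
    using \<open>k \<ge> 1\<close> by (intro mult_right_mono) auto
  have 3: "(int r - 1) * int b + int r * (int j - int i) \<le> (int r - 1) * int b + int r * int j"
    by (intro add_left_mono mult_left_mono) auto
  have "int p + int r * int e \<le> (int r - 1) * int b + int r * int j"
    using order_trans[OF order_trans[OF 2 1] 3] unfolding mult_1 .
  then have "int (p + r * e) \<le> int ((r - 1) * b + r * j)"
    using r by (simp add: of_nat_diff)
  then show ?thesis
    by (simp only: of_nat_le_iff)
qed

text \<open>Converse of \<open>beta_lower\<close>, with i = 0 and k = 1: the inequality for
  \<open>b\<close> is \<open>T \<le> r * N\<close>, and minimality of \<open>b\<close> gives
  \<open>2 * N \<le> T\<close>, so that only m_3, ..., m_n are used.\<close>

lemma beta_representable:
  assumes "j < step_bound" and b: "p + r * e \<le> (r - 1) * b + r * j"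
    and min: "\<And>b'. p + r * e \<le> (r - 1) * b' + r * j \<Longrightarrow> b \<le> b'"
  shows "b > 0 \<and> (\<exists>N T. (j + b) * p + b * e = N * p + T * e \<and> 2 * N \<le> T \<and> T \<le> r * N)"
proof -
  have j: "r * j < p + r * e"
    using \<open>j < step_bound\<close> by (simp add: less_step_bound_iff)
  with b have "b > 0"
    by (cases b) auto
  obtain r' where r': "r = r' + 2"
    using r by (metis add.commute le_Suc_ex)
  obtain b1 where b1: "b = b1 + 1"
    using \<open>b > 0\<close> by (metis Suc_eq_plus1 gr0_implies_Suc)
  have "(r - 1) * b1 + r * j < p + r * e"
  proof (rule ccontr)
    assume "\<not> ?thesis"
    then have "p + r * e \<le> (r - 1) * b1 + r * j"
      by simp
    from min[OF this] b1 show False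
      by simp
  qed
  then have "int ((r' + 1) * b1 + (r' + 2) * j) < int (p + (r' + 2) * e)"
    unfolding r' by (simp only: of_nat_less_iff) simp
  then have lt: "(int r - 1) * (int b - 1) + int r * int j < int p + int r * int e"
    by (simp add: r' b1 algebra_simps)
  have "int (p + (r' + 2) * e) \<le> int ((r' + 1) * b + (r' + 2) * j)"
    using b unfolding r' by (simp only: of_nat_le_iff) simp
  then have le: "int p + int r * int e \<le> (int r - 1) * int b + int r * int j"
    by (simp add: r' algebra_simps)
  have "int j \<le> int p + int e"
  proof -
    have "(p - 1) div r \<le> p - 1"
      by (rule div_le_dividend)
    with \<open>j < step_bound\<close> p show ?thesis
      unfolding step_bound_def by linarith
  qed
  \<comment> \<open>This is \<open>2 * N \<le> T\<close> for the witnesses below. If it failed, then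
    \<open>b - 1\<close> being too small would contradict \<open>j \<le> p + e\<close>.\<close>
  have upper: "2 * int j + int b \<le> int p + 2 * int e"
  proof (rule ccontr)
    assume "\<not> ?thesis"
    then have "int p + 2 * int e - 2 * int j \<le> int b - 1"
      by linarith
    then have "(int r - 1) * (int p + 2 * int e - 2 * int j) \<le> (int r - 1) * (int b - 1)"
      using r by (intro mult_left_mono) auto
    with lt have "int r' * (int p + int e - int j) < 0"
      unfolding r' by (simp add: algebra_simps)
    with \<open>int j \<le> int p + int e\<close> show False
      by (simp add: mult_less_0_iff)
  qed
  have "int r * int e \<le> int r * (int j + int b)"
    using le by (simp add: algebra_simps)
  then have "e \<le> j + b"
    using r by simp
  \<comment> \<open>Trading \<open>e\<close> copies of \<open>p\<close> for \<open>p\<close> copies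
    of \<open>e\<close> leaves \<open>N = j + b - e\<close> and \<open>T = b + p\<close>.\<close>
  define N where "N = j + b - e"
  have N: "int N = int j + int b - int e"
    using \<open>e \<le> j + b\<close> by (simp add: N_def of_nat_diff)
  have "int ((j + b) * p + b * e) = int (N * p + (b + p) * e)"
    by (simp add: N algebra_simps)
  then have "(j + b) * p + b * e = N * p + (b + p) * e"
    by (simp only: of_nat_eq_iff)
  moreover have "2 * N \<le> b + p"
    using upper N by linarith
  moreover have "int (b + p) \<le> int (r * N)"
    using le by (simp add: N algebra_simps)
  then have "b + p \<le> r * N"
    by (simp only: of_nat_le_iff)
  ultimately show ?thesis
    using \<open>b > 0\<close> by blast
qed

text \<open>The least \<open>b\<close> satisfying the linear inequality is representable, hence at
  least \<open>\<beta> j\<close>; by \<open>beta_lower\<close> any coincidence with fewer copies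
  \<open>i < j\<close> satisfies the inequality too. So \<open>\<beta> j\<close> bounds
  \<open>b\<close> even when m_2 is allowed on the other side.\<close>

lemma
  assumes "j < step_bound"
  shows beta_obtain: "\<exists>N T. (j + \<beta> j) * p + \<beta> j * e = N * p + T * e \<and> 2 * N \<le> T \<and> T \<le> r * N"
    and beta_le: "\<And>i b N T. (j + b) * p + b * e = (i + N) * p + T * e \<Longrightarrow>
      i < j \<Longrightarrow> N \<le> T \<Longrightarrow> T \<le> r * N \<Longrightarrow> \<beta> j \<le> b"
proof -
  let ?P = "\<lambda>b. b > 0 \<and> (\<exists>N T. (j + b) * p + b * e = N * p + T * e \<and> 2 * N \<le> T \<and> T \<le> r * N)"
  let ?Q = "\<lambda>b. p + r * e \<le> (r - 1) * b + r * j"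
  define b where "b = (LEAST b. ?Q b)"
  \<comment> \<open>Since \<open>r - 1\<close> is positive, the inequality holds at
    \<open>p + r * e\<close>, so a least \<open>b\<close> exists.\<close>
  have "1 * (p + r * e) \<le> (r - 1) * (p + r * e)"
    using r by (intro mult_le_mono1) linarith
  then have "?Q (p + r * e)"
    unfolding mult_1 by (rule trans_le_add1)
  then have "?Q b"
    unfolding b_def by (rule LeastI)
  have min: "b \<le> b'" if "?Q b'" for b'
    unfolding b_def using that by (rule Least_le)
  have "?P b"
    using assms \<open>?Q b\<close> min by (rule beta_representable)
  then have "?P (\<beta> j)"
    unfolding \<beta>_def by (rule LeastI)
  then show "\<exists>N T. (j + \<beta> j) * p + \<beta> j * e = N * p + T * e \<and> 2 * N \<le> T \<and> T \<le> r * N"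
    by blast
  have "\<beta> j \<le> b"
    unfolding \<beta>_def using \<open>?P b\<close> by (rule Least_le)
  then show "\<beta> j \<le> b'"
    if "(j + b') * p + b' * e = (i + N) * p + T * e" "i < j" "N \<le> T" "T \<le> r * N" for i b' N T
    using min[OF beta_lower[OF that]] by simp
qed

section \<open>Adjoining h m_1 to the semigroup of m_2, ..., m_n\<close>

text \<open>The sums of at most \<open>s\<close> of m_2, ..., m_n, divided by
  \<open>h\<close>.\<close>

definition arith_values where "arith_values s = {N * p + T * e | N T. N \<le> s \<and> N \<le> T \<and> T \<le> r * N}"

text \<open>Here \<open>j\<close> counts the copies of h m_1, each of degree \<open>h\<close> and of
  value \<open>p\<close> after division by \<open>h\<close>.\<close>

definition curve_values where "curve_values s = {(j + N) * p + T * e | j N T. j * h + N \<le> s \<and> N \<le> T \<and> T \<le> r * N}"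

text \<open>The pair \<open>(j, b)\<close> encodes j h m_1 + b m_2; \<open>j = 0\<close> already
  belongs to \<open>arith_values\<close>.\<close>

definition new_values where "new_values s = (SIGMA j:{1..<step_bound}. {b. b < \<beta> j \<and> j * h + b \<le> s})"

text \<open>A descent in the number of copies of h m_1 that stays within the degree bound; the
  excluded situation is exactly that of \<open>new_values\<close>.\<close>

lemma curve_values_step:
  assumes "j > 0" "j * h + N \<le> s" "N \<le> T" "T \<le> r * N" and "x = (j + N) * p + T * e"
    and "\<not> (j < step_bound \<and> N = T \<and> N < \<beta> j)"
  shows "\<exists>i N' T'. i < j \<and> i * h + N' \<le> s \<and> N' \<le> T' \<and> T' \<le> r * N' \<and> x = (i + N') * p + T' * e"
proof -
  consider "step_bound \<le> j" | "N < T" | "j < step_bound" "N = T" "\<beta> j \<le> N"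
    using assms by linarith
  then show ?thesis
  proof cases
    case 1
    \<comment> \<open>\<open>N0\<close> is p/r rounded up. As
      \<open>(N0 + e) * p = N0 * p + p * e\<close>, a batch of \<open>step_bound\<close> copies of h
      m_1 becomes \<open>N0\<close> terms with total offset \<open>p\<close>, which is admissible
      because \<open>N0 \<le> p\<close> and \<open>p \<le> r * N0\<close>.\<close>
    define N0 where "N0 = (p - 1) div r + 1"
    have step_bound: "step_bound = N0 + e"
      by (simp add: step_bound_def N0_def)
    have "p - 1 = r * ((p - 1) div r) + (p - 1) mod r"
      by simp
    moreover have "(p - 1) mod r < r"
      using r by simp
    ultimately have "p \<le> r * N0"
      using p unfolding N0_def distrib_left by linarith
    have "N0 \<le> p"
      using div_le_dividend[of "p - 1" r] p unfolding N0_def by linarith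
    have "step_bound \<le> step_bound * h"
      using h by simp
    obtain i where i: "j = step_bound + i"
      using 1 by (rule le_Suc_ex[THEN exE])
    show ?thesis
    proof (rule exI[of _ i], rule exI[of _ "N + N0"], rule exI[of _ "T + p"], intro conjI)
      show "i < j"
        using e by (simp add: i step_bound)
      show "i * h + (N + N0) \<le> s"
        using assms(2) \<open>step_bound \<le> step_bound * h\<close> unfolding i distrib_right using step_bound by linarith
      show "x = (i + (N + N0)) * p + (T + p) * e"
        unfolding assms(5) i step_bound by (simp add: algebra_simps)
    qed (use assms \<open>p \<le> r * N0\<close> \<open>N0 \<le> p\<close> in \<open>simp_all add: distrib_left\<close>)
  next
    case 2
    \<comment> \<open>Some m_i with i at least 3 occurs, and h m_1 + m_i = m_2 + m_(i-1) raises
      \<open>N\<close> by one and keeps \<open>T\<close>.\<close>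
    obtain i where i: "j = Suc i"
      using assms(1) by (cases j) auto
    show ?thesis
      by (rule exI[of _ i], rule exI[of _ "Suc N"], rule exI[of _ T]) (use assms 2 h in \<open>simp add: i\<close>)
  next
    case 3
    \<comment> \<open>All \<open>N\<close> terms are m_2. The \<open>j\<close> copies of h m_1
      together with \<open>\<beta> j\<close> of these terms are exchanged for a sum of m_3, ...,
      m_n, so no copy of h m_1 remains.\<close>
    from beta_obtain[OF 3(1)] obtain N1 T1
      where 1: "(j + \<beta> j) * p + \<beta> j * e = N1 * p + T1 * e" "2 * N1 \<le> T1" "T1 \<le> r * N1"
      by blast
    \<comment> \<open>The exchange does not raise the degree: with more than
      \<open>j + \<beta> j\<close> terms the right side would be too large.\<close>
    have "N1 \<le> j + \<beta> j"
    proof (rule ccontr)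
      assume "\<not> ?thesis"
      then have "(j + \<beta> j) * p < N1 * p" "\<beta> j * e \<le> T1 * e"
        using p 1(2) by auto
      with 1(1) show False
        by linarith
    qed
    define M where "M = N - \<beta> j"
    have N: "N = M + \<beta> j"
      using 3 by (simp add: M_def)
    have "j \<le> j * h"
      using h by simp
    show ?thesis
    proof (rule exI[of _ 0], rule exI[of _ "M + N1"], rule exI[of _ "M + T1"], intro conjI)
      show "x = (0 + (M + N1)) * p + (M + T1) * e"
        using 1(1) unfolding assms(5) 3(2)[symmetric] N by (simp add: algebra_simps)
      show "M + T1 \<le> r * (M + N1)"
        using 1(3) r by (simp add: distrib_left add_mono)
      show "0 * h + (M + N1) \<le> s"
        using assms(2) N \<open>j \<le> j * h\<close> \<open>N1 \<le> j + \<beta> j\<close> by linarith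
    qed (use assms(1) 1(2) in auto)
  qed
qed

text \<open>The descent stops either at \<open>j = 0\<close>, which is an arithmetic value, or at a
  pair in \<open>new_values\<close>.\<close>

lemma curve_values_eq: "curve_values s = arith_values s \<union> (\<lambda>(j, b). (j + b) * p + b * e) ` new_values s"
proof (rule equalityI; rule subsetI)
  fix x assume "x \<in> curve_values s"
  then obtain j N T where "j * h + N \<le> s" "N \<le> T" "T \<le> r * N" "x = (j + N) * p + T * e"
    by (auto simp: curve_values_def)
  then show "x \<in> arith_values s \<union> (\<lambda>(j, b). (j + b) * p + b * e) ` new_values s"
  proof (induction j arbitrary: N T rule: less_induct)
    case (less j)
    show ?case
    proof (cases "j > 0 \<and> \<not> (j < step_bound \<and> N = T \<and> N < \<beta> j)")
      case True
      then obtain i N' T' where "i < j" "i * h + N' \<le> s" "N' \<le> T'" "T' \<le> r * N'" "x = (i + N') * p + T' * e"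
        using curve_values_step[OF _ less.prems] by blast
      then show ?thesis
        by (rule less.IH)
    next
      case False
      show ?thesis
      proof (cases "j = 0")
        case True
        with less.prems show ?thesis
          by (auto simp: arith_values_def)
      next
        case j: False
        with False less.prems have "(j, N) \<in> new_values s" "x = (j + N) * p + N * e"
          by (auto simp: new_values_def)
        then show ?thesis
          by force
      qed
    qed
  qed
next
  fix x assume "x \<in> arith_values s \<union> (\<lambda>(j, b). (j + b) * p + b * e) ` new_values s"
  then show "x \<in> curve_values s"
  proof (elim UnE imageE)
    assume "x \<in> arith_values s"
    then obtain N T where "N \<le> s" "N \<le> T" "T \<le> r * N" "x = N * p + T * e"
      unfolding arith_values_def by blast
    then have "x = (0 + N) * p + T * e \<and> 0 * h + N \<le> s \<and> N \<le> T \<and> T \<le> r * N"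
      by simp
    then show ?thesis
      unfolding curve_values_def by blast
  next
    fix z assume z: "x = (\<lambda>(j, b). (j + b) * p + b * e) z" "z \<in> new_values s"
    obtain j b where [simp]: "z = (j, b)"
      by fastforce
    have "b \<le> r * b"
      using r by simp
    then have "x = (j + b) * p + b * e \<and> j * h + b \<le> s \<and> b \<le> b \<and> b \<le> r * b"
      using z by (simp add: new_values_def)
    then show ?thesis
      unfolding curve_values_def by blast
  qed
qed

lemma finite_arith_values: "finite (arith_values s)"
proof (rule finite_subset)
  show "arith_values s \<subseteq> (\<lambda>(N, T). N * p + T * e) ` ({..s} \<times> {..r * s})"
  proof
    fix x assume "x \<in> arith_values s"
    then obtain N T where NT: "N \<le> s" "T \<le> r * N" "x = N * p + T * e"
      by (auto simp: arith_values_def)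
    then have "T \<le> r * s"
      by (meson le_trans mult_le_mono2)
    with NT show "x \<in> (\<lambda>(N, T). N * p + T * e) ` ({..s} \<times> {..r * s})"
      by force
  qed
qed simp

lemma finite_new_values: "finite (new_values s)"
  unfolding new_values_def by (intro finite_SigmaI) auto

lemma finite_curve_values: "finite (curve_values s)"
  unfolding curve_values_eq using finite_arith_values finite_new_values by blast

text \<open>By \<open>beta_le\<close>, the value of a new pair has no representation with fewer
  copies of h m_1. With no copies this is disjointness from \<open>arith_values\<close>; between
  pairs with different \<open>j\<close> it is injectivity.\<close>

lemma card_curve_values: "card (curve_values s) = card (arith_values s) + (\<Sum>j\<in>{1..<step_bound}. \<Sum>b<\<beta> j. if j * h + b \<le> s then 1 else 0)"
proof -
  let ?f = "\<lambda>(j, b). (j + b) * p + b * e"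
  have r': "b \<le> r * b" for b
    using r by simp
  note fin = finite_new_values[of s]
  have disj: "arith_values s \<inter> ?f ` new_values s = {}"
  proof -
    have False if "(j, b) \<in> new_values s" "(j + b) * p + b * e = N * p + T * e" "N \<le> T" "T \<le> r * N" for j b N T
      using beta_le[of j b 0 N T] that by (auto simp: new_values_def)
    then show ?thesis
      unfolding arith_values_def by auto
  qed
  have lt: False if "(j, b) \<in> new_values s" "(j + b) * p + b * e = (i + c) * p + c * e" "i < j" for i j b c
    using beta_le[of j b i c c] that r' by (auto simp: new_values_def)
  have inj: "inj_on ?f (new_values s)"
  proof (rule inj_onI, clarify)
    fix j b i c
    assume 1: "(j, b) \<in> new_values s" "(i, c) \<in> new_values s" "(j + b) * p + b * e = (i + c) * p + c * e"
    then have "i = j"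
      using lt[of j b i c] lt[of i c j b] by (metis linorder_neqE_nat)
    with 1(3) have "b * (p + e) = c * (p + e)"
      by (simp add: algebra_simps)
    with \<open>i = j\<close> p show "j = i \<and> b = c"
      by simp
  qed
  have "card (new_values s) = (\<Sum>j\<in>{1..<step_bound}. card {b. b < \<beta> j \<and> j * h + b \<le> s})"
    unfolding new_values_def by (intro card_SigmaI) auto
  also have "\<dots> = (\<Sum>j\<in>{1..<step_bound}. \<Sum>b<\<beta> j. if j * h + b \<le> s then 1 else 0)"
  proof (intro sum.cong refl)
    fix j
    have "{b. b < \<beta> j \<and> j * h + b \<le> s} = {b \<in> {..<\<beta> j}. j * h + b \<le> s}"
      by auto
    then show "card {b. b < \<beta> j \<and> j * h + b \<le> s} = (\<Sum>b<\<beta> j. if j * h + b \<le> s then 1 else 0)"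
      by (simp only: card_eq_sum sum.inter_filter finite_lessThan)
  qed
  finally show ?thesis
    unfolding curve_values_eq using card_Un_disjoint[OF finite_arith_values _ disj] card_image[OF inj] fin by simp
qed

section \<open>Copies of m_1 modulo h\<close>

text \<open>Write q = u + h j with u < h. Modulo \<open>h\<close> the value is u p, which determines
  u by coprimality; the rest of q forms \<open>j\<close> copies of h m_1, and the degree left is
  \<open>s - u\<close>.\<close>

lemma card_residue_decomposition:
  assumes ph: "coprime p h"
  shows "card {q * p + h * (N * p + T * e) | q N T. q + N \<le> s \<and> N \<le> T \<and> T \<le> r * N} =
    (\<Sum>q<h. if q \<le> s then card (curve_values (s - q)) else 0)"
proof -
  let ?B = "\<lambda>q. if q \<le> s then (\<lambda>y. q * p + h * y) ` curve_values (s - q) else {}"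
  have "{q * p + h * (N * p + T * e) | q N T. q + N \<le> s \<and> N \<le> T \<and> T \<le> r * N} = (\<Union>q\<in>{..<h}. ?B q)"
  proof (rule equalityI; rule subsetI)
    fix x assume "x \<in> {q * p + h * (N * p + T * e) | q N T. q + N \<le> s \<and> N \<le> T \<and> T \<le> r * N}"
    then obtain q N T where x: "x = q * p + h * (N * p + T * e)" "q + N \<le> s" "N \<le> T" "T \<le> r * N"
      by blast
    define u where "u = q mod h"
    define j where "j = q div h"
    have q: "q = u + h * j"
      by (simp add: u_def j_def)
    have "u < h"
      using h by (simp add: u_def)
    moreover have "u \<le> s"
      using x(2) unfolding q by linarith
    moreover have "j * h + N \<le> s - u"
      using x(2) unfolding q by (simp add: mult.commute)
    with x(3,4) have "(j + N) * p + T * e \<in> curve_values (s - u)"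
      unfolding curve_values_def by blast
    moreover have "x = u * p + h * ((j + N) * p + T * e)"
      unfolding x(1) q by (simp add: algebra_simps)
    ultimately show "x \<in> (\<Union>q\<in>{..<h}. ?B q)"
      by auto
  next
    fix x assume "x \<in> (\<Union>q\<in>{..<h}. ?B q)"
    then obtain u j N T where x: "u \<le> s" "j * h + N \<le> s - u" "N \<le> T" "T \<le> r * N"
        "x = u * p + h * ((j + N) * p + T * e)"
      by (auto simp: curve_values_def split: if_splits)
    then have "x = (u + j * h) * p + h * (N * p + T * e)" "u + j * h + N \<le> s"
      by (auto simp: algebra_simps)
    with x show "x \<in> {q * p + h * (N * p + T * e) | q N T. q + N \<le> s \<and> N \<le> T \<and> T \<le> r * N}"
      by blast
  qed
  moreover have "card (\<Union>q\<in>{..<h}. ?B q) = (\<Sum>q<h. card (?B q))"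
  proof (rule card_UN_disjoint)
    have "u = v" if "u < h" "v < h" "u * p + h * y = v * p + h * z" for u v y z
    proof -
      have "(int u - int v) * int p = int h * (int z - int y)"
        using that(3)[THEN arg_cong[of _ _ int]] by (simp add: algebra_simps)
      then have "int h dvd (int u - int v) * int p"
        by simp
      then have "int h dvd int u - int v"
        using ph by (simp add: coprime_dvd_mult_left_iff coprime_commute)
      with that(1,2) show ?thesis
        using dvd_imp_le_int[of "int u - int v" "int h"] by fastforce
    qed
    then show "\<forall>u\<in>{..<h}. \<forall>v\<in>{..<h}. u \<noteq> v \<longrightarrow> ?B u \<inter> ?B v = {}"
      by auto
  qed (auto simp: finite_curve_values)
  moreover have "card (?B q) = (if q \<le> s then card (curve_values (s - q)) else 0)" for q
    using h by (auto intro!: card_image inj_onI)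
  ultimately show ?thesis
    by simp
qed

section \<open>Generating functions\<close>

text \<open>A new element of degree k is counted for every \<open>s\<close> from k on, which
  contributes t^k/(1 - t).\<close>

lemma fps_card_curve_values:
  "Abs_fps (\<lambda>s. of_nat (card (curve_values s)) :: rat) = Abs_fps (\<lambda>s. of_nat (card (arith_values s))) +
    (\<Sum>j\<in>{1..<step_bound}. \<Sum>b<\<beta> j. fps_X ^ (j * h + b) * Abs_fps (\<lambda>_. 1))"
proof (rule fps_ext)
  fix s
  have "fps_nth (fps_X ^ k * Abs_fps (\<lambda>_. 1)) s = (of_nat (if k \<le> s then 1 else 0) :: rat)" for k
    by (simp add: fps_X_power_mult_nth)
  note * = this
  show "fps_nth (Abs_fps (\<lambda>s. of_nat (card (curve_values s)) :: rat)) s =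
      fps_nth (Abs_fps (\<lambda>s. of_nat (card (arith_values s))) +
        (\<Sum>j\<in>{1..<step_bound}. \<Sum>b<\<beta> j. fps_X ^ (j * h + b) * Abs_fps (\<lambda>_. 1))) s"
    unfolding fps_nth_Abs_fps card_curve_values fps_add_nth fps_sum_nth of_nat_add of_nat_sum * ..
qed

text \<open>The sum over \<open>b\<close> is a finite geometric sum, and it supplies the second
  factor 1/(1 - t).\<close>

lemma fps_card_difference:
  "Abs_fps (\<lambda>s. of_nat (card (curve_values s)) :: rat) = Abs_fps (\<lambda>s. of_nat (card (arith_values s))) +
    (\<Sum>j\<in>{1..<step_bound}. fps_X ^ (j * h) - fps_X ^ (j * h + \<beta> j)) * Abs_fps (\<lambda>_. 1) ^ 2"
proof -
  let ?J = "Abs_fps (\<lambda>_. 1) :: rat fps"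
  have J: "(1 - fps_X) * ?J = 1"
    by (rule fps_geometric_inverse)
  have geo: "(\<Sum>b<\<beta> j. fps_X ^ (j * h + b) * ?J) = (fps_X ^ (j * h) - fps_X ^ (j * h + \<beta> j)) * ?J ^ 2" for j
  proof -
    let ?S = "\<Sum>b<\<beta> j. fps_X ^ b :: rat fps"
    have "?S = (1 - fps_X) * ?J * ?S"
      by (simp only: J mult_1)
    also have "\<dots> = (1 - fps_X) * ?S * ?J"
      by (simp only: mult_ac)
    also have "(1 - fps_X) * ?S = 1 - fps_X ^ \<beta> j"
      by (rule one_diff_power_eq[symmetric])
    finally have S: "?S = (1 - fps_X ^ \<beta> j) * ?J" .
    have "(\<Sum>b<\<beta> j. fps_X ^ (j * h + b) * ?J) = fps_X ^ (j * h) * ?S * ?J"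
      by (simp only: power_add sum_distrib_left sum_distrib_right)
    also have "\<dots> = (fps_X ^ (j * h) - fps_X ^ (j * h + \<beta> j)) * ?J ^ 2"
      unfolding S power_add power2_eq_square
      by (simp only: left_diff_distrib right_diff_distrib mult_1_left mult_1_right mult_ac)
    finally show ?thesis .
  qed
  show ?thesis
    unfolding fps_card_curve_values geo sum_distrib_right ..
qed

lemma fps_residue_decomposition:
  "Abs_fps (\<lambda>s. of_nat (\<Sum>q<h. if q \<le> s then card (curve_values (s - q)) else 0) :: rat) =
    (\<Sum>j=0..h-1. fps_X ^ j) * Abs_fps (\<lambda>s. of_nat (card (curve_values s)))"
proof (rule fps_ext)
  fix s
  have range: "{0..h-1} = {..<h}"
    using h by auto
  have "fps_nth (fps_X ^ q * Abs_fps (\<lambda>s. of_nat (card (curve_values s)))) s =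
      (of_nat (if q \<le> s then card (curve_values (s - q)) else 0) :: rat)" for q
    by (simp add: fps_X_power_mult_nth)
  note * = this
  show "fps_nth (Abs_fps (\<lambda>s. of_nat (\<Sum>q<h. if q \<le> s then card (curve_values (s - q)) else 0) :: rat)) s =
      fps_nth ((\<Sum>j=0..h-1. fps_X ^ j) * Abs_fps (\<lambda>s. of_nat (card (curve_values s)))) s"
    unfolding range sum_distrib_right fps_sum_nth * fps_nth_Abs_fps of_nat_sum ..
qed

text \<open>Each exponent from \<open>h\<close> to \<open>k * h - 1\<close> is uniquely u + i h with
  u < h and 1 \<le> i < k; the induction appends one block of length \<open>h\<close>.\<close>

lemma sum_powers_blocks:
  fixes x :: "'a::comm_ring_1"
  shows "(\<Sum>j=0..h-1. x ^ j) * (\<Sum>i\<in>{1..<k}. x ^ (i * h)) = (\<Sum>j\<in>{h..<k * h}. x ^ j)"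
proof (induction k)
  case 0
  then show ?case by simp
next
  case (Suc k)
  have "{0..h-1} = {..<h}"
    using h by auto
  show ?case
  proof (cases "k = 0")
    case False
    then have "h \<le> k * h"
      by simp
    then have "(\<Sum>j\<in>{h..<Suc k * h}. x ^ j) = (\<Sum>j\<in>{h..<k * h}. x ^ j) + (\<Sum>j\<in>{k * h..<k * h + h}. x ^ j)"
      by (subst sum.atLeastLessThan_concat) (simp_all add: add.commute)
    also have "(\<Sum>j\<in>{k * h..<k * h + h}. x ^ j) = (\<Sum>j<h. x ^ j) * x ^ (k * h)"
      using sum.shift_bounds_nat_ivl[of "\<lambda>j. x ^ j" 0 "k * h" h]
      by (simp add: power_add sum_distrib_right atLeast0LessThan add.commute)
    finally show ?thesis
      using Suc False \<open>{0..h-1} = {..<h}\<close> by (simp add: distrib_left)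
  qed simp
qed

end

section \<open>The Hilbert series of the curve\<close>

theorem theorem3p16:
  fixes n h d \<delta> :: nat and m \<beta> :: "nat \<Rightarrow> nat"
  assumes "infinite (UNIV :: 'a::field set)"
    and "n \<ge> 3"
    and "\<forall>i\<in>{1..n}. m i > 0"
    and "strict_mono_on {1..n} m"
    and "h > 0" and "d > 0"
    and "\<forall>i\<in>{2..n}. m i = h * m 1 + (i - 1) * d"
    and "gcd (m 1) d = 1"
    and "h > 1"
    and "h dvd d"
    and "\<delta> = ((m 1 - 1) div (n - 1)) * h + d + h"
    and "\<forall>j\<in>{0..\<delta> div h - 1}.
           \<beta> j = (LEAST b. b > 0 \<and> (j * h) * m 1 + b * m 2 \<in> nat_combinations {3..n} m)"
  shows "hilbert_series {1..n+1} (curve_ideal 1 n m :: 'a mpoly set) =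
      (\<Sum>j=0..h-1. fps_X ^ j) * hilbert_series {2..n+1} (curve_ideal 2 n m :: 'a mpoly set)
      + ((\<Sum>j=h..\<delta>-1. fps_X ^ j)
          - (\<Sum>j=0..h-1. fps_X ^ j) * (\<Sum>i=1..\<delta> div h - 1. fps_X ^ (i * h + \<beta> i)))
        / (1 - fps_X) ^ 2"
proof -
  obtain e where d: "d = h * e"
    using \<open>h dvd d\<close> by (rule dvdE)
  have coprime: "coprime (m 1) d"
    using assms(8) by (simp add: coprime_iff_gcd_eq_1)
  have "coprime (m 1) e" "coprime (m 1) h"
    using coprime unfolding d by simp_all
  interpret S: curve_semigroup "m 1" e "n - 1" h
    using assms(2,3,5,6) d \<open>coprime (m 1) e\<close> by unfold_locales auto
  have mi: "m i = h * (m 1 + (i - 1) * e)" if "i \<in> {2..n}" for i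
    using assms(7) that by (simp add: d algebra_simps)
  have le: "m i \<le> m n" if "i \<in> {1..n}" for i
    using strict_mono_onD[OF assms(4) that, of n] that by (cases "i = n") auto
  have comb2: "(\<exists>c. (\<Sum>i\<in>{2..n}. c i) = N \<and> x = (\<Sum>i\<in>{2..n}. c i * m i)) \<longleftrightarrow>
      (\<exists>T. x = h * (N * m 1 + T * e) \<and> N \<le> T \<and> T \<le> (n - 1) * N)" for N x
    using exists_sum_arith_progression[of 2 n m h "m 1" e N x] mi assms(2) by simp
  have comb3: "(\<exists>c. (\<Sum>i\<in>{3..n}. c i) = N \<and> x = (\<Sum>i\<in>{3..n}. c i * m i)) \<longleftrightarrow>
      (\<exists>T. x = h * (N * m 1 + T * e) \<and> 2 * N \<le> T \<and> T \<le> (n - 1) * N)" for N x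
    using exists_sum_arith_progression[of 3 n m h "m 1" e N x] mi assms(2) by simp
  have "hilbert_series {2..n+1} (curve_ideal 2 n m :: 'a mpoly set) = Abs_fps (\<lambda>s. of_nat (card (S.arith_values s)))"
  proof -
    have "bounded_combinations {2..n} m s = (\<lambda>y. h * y) ` S.arith_values s" for s
      unfolding bounded_combinations_eq comb2 S.arith_values_def by blast
    \<comment> \<open>Multiplication by \<open>h > 0\<close> is injective, so the values may be
      counted after division by \<open>h\<close>.\<close>
    moreover have "card ((\<lambda>y. h * y) ` S.arith_values s) = card (S.arith_values s)" for s
      using assms(5) by (intro card_image inj_onI) simp
    ultimately show ?thesis
      using hilbert_series_curve[of 2 n m] le assms(2) by simp
  qed
  moreover have "hilbert_series {1..n+1} (curve_ideal 1 n m :: 'a mpoly set) =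
      (\<Sum>j=0..h-1. fps_X ^ j) * Abs_fps (\<lambda>s. of_nat (card (S.curve_values s)))"
  proof -
    have "bounded_combinations {1..n} m s =
        {q * m 1 + h * (N * m 1 + T * e) | q N T. q + N \<le> s \<and> N \<le> T \<and> T \<le> (n - 1) * N}" for s
      using assms(2) by (subst bounded_combinations_from_1) (simp, unfold comb2, blast)
    then show ?thesis
      using hilbert_series_curve[of 1 n m] le assms(2)
        S.card_residue_decomposition[OF \<open>coprime (m 1) h\<close>] S.fps_residue_decomposition by simp
  qed
  moreover have \<delta>: "\<delta> = S.step_bound * h"
    unfolding assms(11) d S.step_bound_def by (simp add: algebra_simps)
  moreover have D: "\<delta> div h = S.step_bound"
    using assms(5) by (simp add: \<delta>)
  \<comment> \<open>Dividing the membership condition by \<open>h\<close> shows that both minima are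
    taken over the same set.\<close>
  moreover have "\<beta> j = S.\<beta> j" if "j \<in> {1..<S.step_bound}" for j
  proof -
    have "(j * h) * m 1 + b * m 2 \<in> nat_combinations {3..n} m \<longleftrightarrow>
        (\<exists>N T. (j + b) * m 1 + b * e = N * m 1 + T * e \<and> 2 * N \<le> T \<and> T \<le> (n - 1) * N)" for b
    proof -
      have "(j * h) * m 1 + b * m 2 = h * ((j + b) * m 1 + b * e)"
        using mi[of 2] assms(2) by (simp add: algebra_simps)
      then show ?thesis
        unfolding nat_combinations_eq comb3 mem_Collect_eq using assms(5) by simp
    qed
    moreover have "j \<in> {0..\<delta> div h - 1}"
      using that by (auto simp: D)
    ultimately show ?thesis
      using assms(12) unfolding S.\<beta>_def by simp
  qed
  then have "(\<Sum>i=1..\<delta> div h - 1. fps_X ^ (i * h + \<beta> i)) = (\<Sum>i\<in>{1..<S.step_bound}. fps_X ^ (i * h + S.\<beta> i) :: rat fps)"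
    unfolding D by (intro sum.cong) auto
  \<comment> \<open>As \<open>\<delta> > 0\<close>, the closed range ending at
    \<open>\<delta> - 1\<close> is the half-open one of \<open>sum_powers_blocks\<close>.\<close>
  moreover have "{h..\<delta> - 1} = {h..<S.step_bound * h}"
    using assms(5) by (auto simp: \<delta> S.step_bound_def)
  then have "(\<Sum>j=h..\<delta>-1. fps_X ^ j) = (\<Sum>j=0..h-1. fps_X ^ j) * (\<Sum>i\<in>{1..<S.step_bound}. fps_X ^ (i * h) :: rat fps)"
    by (simp only: S.sum_powers_blocks)
  \<comment> \<open>The factor 1 + ... + t^(h-1) distributes over the differences: the powers t^(ih)
    fill the range from \<open>h\<close> to \<open>\<delta> - 1\<close>, and the powers with
    \<beta>_i are subtracted.\<close>
  ultimately show ?thesis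
    by (simp only: S.fps_card_difference fps_divide_one_minus_X_squared sum_subtractf algebra_simps)
qed

end
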